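(* Let $G$ be a $D(k)$ graph and let $C$ be any $\chi_d$-coloring of $G$. Then every color class in $C$ is dominated by some vertex of $G$, and every vertex of $G$ dominates exactly one color class in $C$.
   Context: All graphs are finite, simple and connected. $\gamma(G)$ denotes the domination number and $\chi(G)$ the chromatic number of $G$. A (proper) coloring of $G$ with $k$ colors is a partition $C=(V_1,\dots,V_k)$ of $V(G)$ into nonempty independent sets, called color classes. A vertex $u$ dominates the color class $V_i$ if $u$ is adjacent to every vertex of $V_i$, or if $V_i=\{u\}$. A dominator coloring of $G$ is a coloring in which every vertex dominates at least one color class; the dominator chromatic number $\chi_d(G)$ is the minimum number of colors in a dominator coloring of $G$, and a $\chi_d$-coloring is a dominator coloring with exactly $\chi_d(G)$ colors. A graph $G$ is called a $D(k)$ graph if $\gamma(G)=\chi(G)=\chi_d(G)=k$. *)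

theory Defs
  imports "HOL-Library.Disjoint_Sets" "Graph_Theory.Graph_Theory"
begin

(* A simple graph is a pair_graph: finite, loopless, with a symmetric set of arcs, so that
   u and v are adjacent iff (u, v) is an arc.  Library connectedness entails nonemptiness.
   In the library, "dominates" is the name of plain arc adjacency; it is not used below. *)

definition dominating_set :: "'a pair_pre_digraph \<Rightarrow> 'a set \<Rightarrow> bool" where
  "dominating_set G D \<longleftrightarrow>
     D \<subseteq> pverts G \<and> (\<forall>v \<in> pverts G - D. \<exists>u \<in> D. (u, v) \<in> parcs G)"

definition domination_number :: "'a pair_pre_digraph \<Rightarrow> nat" where
  "domination_number G = (LEAST n. \<exists>D. dominating_set G D \<and> card D = n)"

definition independent_set :: "'a pair_pre_digraph \<Rightarrow> 'a set \<Rightarrow> bool" where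
  "independent_set G V \<longleftrightarrow>
     V \<subseteq> pverts G \<and> (\<forall>u \<in> V. \<forall>v \<in> V. (u, v) \<notin> parcs G)"

(* A coloring is the set of its color classes: the numbering of the classes is immaterial, and
   since the classes are nonempty and disjoint, the number of colors is the cardinality.
   partition_on includes that every class is nonempty. *)
definition coloring :: "'a pair_pre_digraph \<Rightarrow> 'a set set \<Rightarrow> bool" where
  "coloring G C \<longleftrightarrow> partition_on (pverts G) C \<and> (\<forall>V \<in> C. independent_set G V)"

definition chromatic_number :: "'a pair_pre_digraph \<Rightarrow> nat" where
  "chromatic_number G = (LEAST n. \<exists>C. coloring G C \<and> card C = n)"

definition dominates_class :: "'a pair_pre_digraph \<Rightarrow> 'a \<Rightarrow> 'a set \<Rightarrow> bool" where
  "dominates_class G u V \<longleftrightarrow> (\<forall>v \<in> V. (u, v) \<in> parcs G) \<or> V = {u}"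

definition dominator_coloring :: "'a pair_pre_digraph \<Rightarrow> 'a set set \<Rightarrow> bool" where
  "dominator_coloring G C \<longleftrightarrow>
     coloring G C \<and> (\<forall>u \<in> pverts G. \<exists>V \<in> C. dominates_class G u V)"

(* The minimum exists: in a finite loopless graph the singletons form a dominator coloring. *)
definition dominator_chromatic_number :: "'a pair_pre_digraph \<Rightarrow> nat" where
  "dominator_chromatic_number G = (LEAST n. \<exists>C. dominator_coloring G C \<and> card C = n)"

definition chi_d_coloring :: "'a pair_pre_digraph \<Rightarrow> 'a set set \<Rightarrow> bool" where
  "chi_d_coloring G C \<longleftrightarrow>
     dominator_coloring G C \<and> card C = dominator_chromatic_number G"

definition D_graph :: "nat \<Rightarrow> 'a pair_pre_digraph \<Rightarrow> bool" where
  "D_graph k G \<longleftrightarrow>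
     pair_graph G \<and> connected (with_proj G) \<and>
     domination_number G = k \<and> chromatic_number G = k \<and> dominator_chromatic_number G = k"

end

theory Submission
  imports Defs
begin

text \<open>
  A system of representatives of the colour classes dominates \<open>G\<close>, and so does a set containing,
  for each class, some vertex dominating that class. If one class were dominated by no vertex, its
  representative could be dropped from the former; if one vertex dominated two classes, it could
  serve for both in the latter. Either way \<open>\<gamma>(G) < k\<close>.
\<close>

lemma domination_number_le: "dominating_set G D \<Longrightarrow> domination_number G \<le> card D"
  unfolding domination_number_def by (rule Least_le) blast

text \<open>A vertex \<open>v\<close> that is not a representative dominates some \<open>V\<close>
  in \<open>B\<close>, and \<open>V\<close> is not \<open>{v}\<close>, whose representative would be
  \<open>v\<close>. So \<open>v\<close> is adjacent to all of \<open>V\<close>, in particular to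
  \<open>r V\<close>. A subfamily \<open>B\<close> is allowed so that a class can be left
  out.\<close>

lemma dominating_set_representatives:
  assumes "pair_graph G" "coloring G C" "B \<subseteq> C"
    and dom: "\<And>u. u \<in> pverts G \<Longrightarrow> \<exists>V \<in> B. dominates_class G u V"
    and rep: "\<And>V. V \<in> B \<Longrightarrow> r V \<in> V"
  shows "dominating_set G (r ` B)"
  unfolding dominating_set_def
proof (intro conjI ballI)
  interpret pair_graph G by fact
  have "V \<subseteq> pverts G" if "V \<in> B" for V
    using that assms(2,3) unfolding coloring_def independent_set_def by blast
  then show "r ` B \<subseteq> pverts G" using rep by blast
  fix v assume v: "v \<in> pverts G - r ` B"
  then obtain V where V: "V \<in> B" "dominates_class G v V" using dom by blast
  have "V \<noteq> {v}" using rep[OF V(1)] V(1) v by auto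
  then have "(v, r V) \<in> parcs G"
    using V rep unfolding dominates_class_def by blast
  then have "(r V, v) \<in> parcs G" by (rule arcs_symmetric)
  then show "\<exists>u \<in> r ` B. (u, v) \<in> parcs G" using V(1) by blast
qed

text \<open>A vertex \<open>v\<close> outside the image lies in some class \<open>V\<close>; the
  case \<open>V = {f V}\<close> would give \<open>v = f V\<close>, so \<open>f V\<close> is adjacent
  to \<open>v\<close>.\<close>

lemma dominating_set_class_dominators:
  assumes "coloring G C"
    and "\<And>V. V \<in> C \<Longrightarrow> f V \<in> pverts G" "\<And>V. V \<in> C \<Longrightarrow> dominates_class G (f V) V"
  shows "dominating_set G (f ` C)"
  unfolding dominating_set_def
proof (intro conjI ballI)
  show "f ` C \<subseteq> pverts G" using assms(2) by blast
  fix v assume v: "v \<in> pverts G - f ` C"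
  then obtain V where V: "V \<in> C" "v \<in> V"
    using assms(1) unfolding coloring_def partition_on_def by blast
  then show "\<exists>u \<in> f ` C. (u, v) \<in> parcs G"
    using v assms(3)[OF V(1)] unfolding dominates_class_def by blast
qed

theorem theorem1:
  fixes G :: "'a pair_pre_digraph" and k :: nat and C :: "'a set set"
  assumes "D_graph k G"
    and "chi_d_coloring G C"
  shows "(\<forall>V \<in> C. \<exists>u \<in> pverts G. dominates_class G u V) \<and>
         (\<forall>u \<in> pverts G. \<exists>!V. V \<in> C \<and> dominates_class G u V)"
proof -
  have G: "pair_graph G" using assms(1) unfolding D_graph_def by blast
  then interpret pair_graph G .
  have card_C: "card C = domination_number G" and col: "coloring G C"
    and dom: "\<And>u. u \<in> pverts G \<Longrightarrow> \<exists>V \<in> C. dominates_class G u V"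
    using assms unfolding D_graph_def chi_d_coloring_def dominator_coloring_def by auto
  have part: "partition_on (pverts G) C" using col unfolding coloring_def by blast
  then have fin: "finite C" by (rule finite_elements[rotated]) simp
  have dominated: "\<exists>u \<in> pverts G. dominates_class G u V" if V: "V \<in> C" for V
  proof (rule ccontr)
    assume neg: "\<not> ?thesis"
    have "dominating_set G ((\<lambda>W. SOME w. w \<in> W) ` (C - {V}))"
    proof (rule dominating_set_representatives[OF G col])
      \<comment> \<open>The class that \<open>u\<close> dominates cannot be \<open>V\<close>, by
        \<open>neg\<close>.\<close>
      show "\<exists>W \<in> C - {V}. dominates_class G u W" if "u \<in> pverts G" for u
        using dom[OF that] neg that by blast
      show "(SOME w. w \<in> W) \<in> W" if "W \<in> C - {V}" for W
        using that part by (metis DiffD1 partition_onD3 some_in_eq)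
    qed blast
    then have "card C \<le> card ((\<lambda>W. SOME w. w \<in> W) ` (C - {V}))"
      using domination_number_le card_C by metis
    also have "\<dots> \<le> card (C - {V})" using fin by (intro card_image_le) simp
    also have "\<dots> < card C" using fin V by (rule card_Diff1_less)
    finally show False by simp
  qed
  have unique: "V = W"
    if u: "u \<in> pverts G" and V: "V \<in> C" "dominates_class G u V"
      and W: "W \<in> C" "dominates_class G u W" for u V W
  proof (rule ccontr)
    assume "V \<noteq> W"
    \<comment> \<open>The first claim supplies a dominator for every class; redirecting
      \<open>V\<close> and \<open>W\<close> to \<open>u\<close> preserves this property.\<close>
    obtain f where f: "\<And>X. X \<in> C \<Longrightarrow> f X \<in> pverts G \<and> dominates_class G (f X) X"
      using dominated by metis
    let ?f = "f(V := u, W := u)"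
    have "dominating_set G (?f ` C)"
      using f u V W by (intro dominating_set_class_dominators[OF col]) auto
    then have "card C \<le> card (?f ` C)"
      using domination_number_le card_C by metis
    \<comment> \<open>An image of \<open>C\<close> has at most \<open>card C\<close> elements, so
      equality holds and \<open>?f\<close> is injective, although it sends both \<open>V\<close> and
      \<open>W\<close> to \<open>u\<close>.\<close>
    then have "inj_on ?f C"
      using fin by (intro eq_card_imp_inj_on le_antisym card_image_le)
    then show False using V W \<open>V \<noteq> W\<close> by (auto dest: inj_onD[of _ _ V W])
  qed
  show ?thesis using dominated dom unique by blast
qed

end
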